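(* Let $n,m,\ell$ be integers with $1\leq \ell+1\leq m\leq n$. Let $X_1,X_2,\ldots,X_n$ be i.i.d. real random variables whose common distribution is continuous. Then $$R\left(\min_{i:1\leq i\leq m}X_i,\ \min_{j:\ell+1\leq j\leq n}X_j\right)=\frac{m-\ell}{\sqrt{m(n-\ell)}},$$ where $R(\cdot,\cdot)$ denotes the maximal correlation coefficient.
   Context: For two non-degenerate random variables $X$ and $Y$ on the same probability space, the maximal correlation coefficient is $$R(X,Y)=\sup\frac{\operatorname{Cov}(\varphi(X),\psi(Y))}{\sqrt{\operatorname{Var}(\varphi(X))\operatorname{Var}(\psi(Y))}},$$ where the supremum is over all (real-valued) measurable functions $\varphi$ and $\psi$ such that $\operatorname{Var}(\varphi(X)),\operatorname{Var}(\psi(Y))\in(0,\infty)$. A real random variable is called continuous if its cumulative distribution function $F(x)=P(X\le x)$ is a continuous function (a density is not required). *)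

theory Defs
  imports "HOL-Probability.Probability"
begin

context prob_space
begin

definition covariance :: "('a \<Rightarrow> real) \<Rightarrow> ('a \<Rightarrow> real) \<Rightarrow> real" where
  "covariance U V = expectation (\<lambda>\<omega>. (U \<omega> - expectation U) * (V \<omega> - expectation V))"

(* Var(U) lies in (0, infinity). The Bochner integral of a non-integrable function is 0,
   so finiteness of the variance is stated as square integrability. *)
definition finite_positive_variance :: "('a \<Rightarrow> real) \<Rightarrow> bool" where
  "finite_positive_variance U \<longleftrightarrow>
     random_variable borel U \<and> integrable M (\<lambda>\<omega>. (U \<omega>)\<^sup>2) \<and> variance U > 0"

(* Meaningful for non-degenerate X and Y only: then the set is nonempty, and it is bounded
   above by 1 by the Cauchy-Schwarz inequality, so that Sup is the actual supremum. *)
definition max_correlation :: "('a \<Rightarrow> real) \<Rightarrow> ('a \<Rightarrow> real) \<Rightarrow> real" where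
  "max_correlation X Y =
     Sup {covariance (\<lambda>\<omega>. \<phi> (X \<omega>)) (\<lambda>\<omega>. \<psi> (Y \<omega>)) /
            sqrt (variance (\<lambda>\<omega>. \<phi> (X \<omega>)) * variance (\<lambda>\<omega>. \<psi> (Y \<omega>))) | \<phi> \<psi>.
          \<phi> \<in> borel_measurable borel \<and> \<psi> \<in> borel_measurable borel \<and>
          finite_positive_variance (\<lambda>\<omega>. \<phi> (X \<omega>)) \<and>
          finite_positive_variance (\<lambda>\<omega>. \<psi> (Y \<omega>))}"

end

end

theory Submission
  imports Defs
begin

text \<open>
  Upper bound. For a symmetric square integrable mean-zero function $f$ of $k+1$ i.i.d. variables,
  conditioning on $k$ of them shrinks the second moment by a factor of at least $(k+1)/k$:
  if $g_j$ is the conditional expectation of $f$ given all variables but the $j$-th, then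
  the projection property gives $E f g_j = E g_j^2$, induction bounds $E g_i g_j$ for $i \neq j$, and
  expanding $E(f - \frac1k \sum_j g_j)^2 \geq 0$ gives the claim. Iterating, conditioning on the variables
  of $C = A \cap B$ shrinks the second moments of $\varphi(\min_A X)$ and $\psi(\min_B X)$ by
  $|C|/|A|$ and $|C|/|B|$. As these two are conditionally independent given the variables
  of $C$, the Cauchy-Schwarz inequality yields the bound $|C| / \sqrt{|A| |B|}$.

  Lower bound. For $\varphi = \psi = 1_{(t, \infty)}$ the correlation is an explicit function of
  $P(X_1 > t)$ that tends to $|C| / \sqrt{|A| |B|}$ as $P(X_1 > t) \to 1$; continuity
  of the distribution makes all values of this probability in $(0,1)$ available.
\<close>

section \<open>Fubini for independent variables and the Cauchy-Schwarz inequality\<close>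

text \<open>Independence makes the joint law of \<open>(Z, Y)\<close> the product of the two laws,
  so Fubini on that product can be pulled back to \<open>M\<close>. The inner integral runs over a
  second copy \<open>\<omega>'\<close> of the same space.\<close>

lemma (in prob_space) indep_var_Fubini:
  fixes H :: "'b \<times> 'b \<Rightarrow> real"
  assumes ind: "indep_var N Z L Y"
    and H[measurable]: "H \<in> borel_measurable (N \<Otimes>\<^sub>M L)"
    and int: "integrable M (\<lambda>\<omega>. H (Z \<omega>, Y \<omega>))"
  shows "AE \<omega> in M. integrable M (\<lambda>\<omega>'. H (Z \<omega>, Y \<omega>'))"
    and "integrable M (\<lambda>\<omega>. expectation (\<lambda>\<omega>'. H (Z \<omega>, Y \<omega>')))"
    and "expectation (\<lambda>\<omega>. H (Z \<omega>, Y \<omega>)) = expectation (\<lambda>\<omega>. expectation (\<lambda>\<omega>'. H (Z \<omega>, Y \<omega>')))"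
proof -
  have Z[measurable]: "Z \<in> measurable M N" and Y[measurable]: "Y \<in> measurable M L"
    and eq: "distr M N Z \<Otimes>\<^sub>M distr M L Y = distr M (N \<Otimes>\<^sub>M L) (\<lambda>x. (Z x, Y x))"
    using ind by (auto simp: indep_var_distribution_eq)
  interpret Z: prob_space "distr M N Z" by (rule prob_space_distr) fact
  interpret Y: prob_space "distr M L Y" by (rule prob_space_distr) fact
  interpret P: pair_sigma_finite "distr M N Z" "distr M L Y" ..
  have intP: "integrable (distr M N Z \<Otimes>\<^sub>M distr M L Y) H"
    unfolding eq using int by (subst integrable_distr_eq) auto
  have I: "(\<integral>y. H (z, y) \<partial>distr M L Y) = expectation (\<lambda>\<omega>'. H (z, Y \<omega>'))"
    "integrable (distr M L Y) (\<lambda>y. H (z, y)) \<longleftrightarrow> integrable M (\<lambda>\<omega>'. H (z, Y \<omega>'))"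
    if [measurable]: "z \<in> space N" for z
    by (subst integral_distr integrable_distr_eq; measurable)+
  have Zs: "Z \<omega> \<in> space N" if "\<omega> \<in> space M" for \<omega>
    using measurable_space[OF Z that] .
  have [measurable]: "Measurable.pred N (\<lambda>z. integrable (distr M L Y) (\<lambda>y. H (z, y)))"
    by measurable
  have "AE \<omega> in M. integrable (distr M L Y) (\<lambda>y. H (Z \<omega>, y))"
    using P.AE_integrable_fst'[OF intP] by (subst (asm) AE_distr_iff) auto
  with AE_space show "AE \<omega> in M. integrable M (\<lambda>\<omega>'. H (Z \<omega>, Y \<omega>'))"
    by eventually_elim (simp add: I Zs)
  have "integrable M (\<lambda>\<omega>. \<integral>y. H (Z \<omega>, y) \<partial>distr M L Y)"
    using P.integrable_fst'[OF intP] by (subst (asm) integrable_distr_eq) auto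
  then show "integrable M (\<lambda>\<omega>. expectation (\<lambda>\<omega>'. H (Z \<omega>, Y \<omega>')))"
    by (rule Bochner_Integration.integrable_cong[THEN iffD1, rotated -1]) (simp_all add: I Zs)
  have "expectation (\<lambda>\<omega>. H (Z \<omega>, Y \<omega>)) = (\<integral>p. H p \<partial>distr M (N \<Otimes>\<^sub>M L) (\<lambda>x. (Z x, Y x)))"
    by (subst integral_distr) auto
  also have "\<dots> = (\<integral>z. (\<integral>y. H (z, y) \<partial>distr M L Y) \<partial>distr M N Z)"
    unfolding eq[symmetric] using P.integral_fst'[OF intP] by simp
  also have "\<dots> = expectation (\<lambda>\<omega>. \<integral>y. H (Z \<omega>, y) \<partial>distr M L Y)"
    by (subst integral_distr) auto
  also have "\<dots> = expectation (\<lambda>\<omega>. expectation (\<lambda>\<omega>'. H (Z \<omega>, Y \<omega>')))"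
    by (rule Bochner_Integration.integral_cong) (simp_all add: I Zs)
  finally show "expectation (\<lambda>\<omega>. H (Z \<omega>, Y \<omega>)) = expectation (\<lambda>\<omega>. expectation (\<lambda>\<omega>'. H (Z \<omega>, Y \<omega>')))" .
qed

lemma square_integrable_imp_integrable_mult:
  fixes f g :: "_ \<Rightarrow> real"
  assumes [measurable]: "f \<in> borel_measurable M" "g \<in> borel_measurable M"
    and f: "integrable M (\<lambda>x. (f x)\<^sup>2)" and g: "integrable M (\<lambda>x. (g x)\<^sup>2)"
  shows "integrable M (\<lambda>x. f x * g x)"
proof (rule Bochner_Integration.integrable_bound)
  show "integrable M (\<lambda>x. (f x)\<^sup>2 + (g x)\<^sup>2)" using f g by simp
  show "AE x in M. norm (f x * g x) \<le> norm ((f x)\<^sup>2 + (g x)\<^sup>2)"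
  proof (rule AE_I2)
    fix x
    have "2 * (\<bar>f x\<bar> * \<bar>g x\<bar>) \<le> (f x)\<^sup>2 + (g x)\<^sup>2"
      using sum_squares_bound[of "\<bar>f x\<bar>" "\<bar>g x\<bar>"] by simp
    moreover have "0 \<le> \<bar>f x\<bar> * \<bar>g x\<bar>" by simp
    ultimately show "norm (f x * g x) \<le> norm ((f x)\<^sup>2 + (g x)\<^sup>2)"
      unfolding real_norm_def abs_mult by linarith
  qed
qed simp

lemma Cauchy_Schwarz_integral:
  fixes f g :: "_ \<Rightarrow> real"
  assumes [measurable]: "f \<in> borel_measurable M" "g \<in> borel_measurable M"
    and f: "integrable M (\<lambda>x. (f x)\<^sup>2)" and g: "integrable M (\<lambda>x. (g x)\<^sup>2)"
  shows "integral\<^sup>L M (\<lambda>x. f x * g x) \<le> sqrt (integral\<^sup>L M (\<lambda>x. (f x)\<^sup>2) * integral\<^sup>L M (\<lambda>x. (g x)\<^sup>2))"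
proof -
  define a b c where "a = integral\<^sup>L M (\<lambda>x. (f x)\<^sup>2)" and "b = integral\<^sup>L M (\<lambda>x. f x * g x)"
    and "c = integral\<^sup>L M (\<lambda>x. (g x)\<^sup>2)"
  have fg: "integrable M (\<lambda>x. f x * g x)"
    by (rule square_integrable_imp_integrable_mult) fact+
  have q: "0 \<le> s\<^sup>2 * a - 2 * s * t * b + t\<^sup>2 * c" for s t
  proof -
    have "0 \<le> integral\<^sup>L M (\<lambda>x. (s * f x - t * g x)\<^sup>2)" by simp
    also have "(\<lambda>x. (s * f x - t * g x)\<^sup>2)
        = (\<lambda>x. s\<^sup>2 * (f x)\<^sup>2 - 2 * s * t * (f x * g x) + t\<^sup>2 * (g x)\<^sup>2)"
      by (auto simp: power2_eq_square algebra_simps)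
    also have "integral\<^sup>L M \<dots> = s\<^sup>2 * a - 2 * s * t * b + t\<^sup>2 * c"
      using f g fg by (simp add: a_def b_def c_def)
    finally show ?thesis .
  qed
  have c0: "0 \<le> c" by (simp add: c_def)
  have "b\<^sup>2 \<le> a * c"
  proof (cases "c = 0")
    case True
    have "b = 0"
    proof (rule ccontr)
      assume "b \<noteq> 0"
      \<comment> \<open>With \<open>c = 0\<close> these values of \<open>s\<close> and
        \<open>t\<close> turn the quadratic form into \<open>a - (a + 1) = -1\<close>.\<close>
      with q[of 1 "(a + 1) / (2 * b)"] True show False by (simp add: field_simps)
    qed
    with True show ?thesis by simp
  next
    case False
    \<comment> \<open>At \<open>s = c\<close>, \<open>t = b\<close> the form equals
      \<open>c * (a * c - b^2)\<close>.\<close>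
    have "0 \<le> c * (a * c - b\<^sup>2)"
      using q[of c b] by (simp add: power2_eq_square algebra_simps)
    with False c0 show ?thesis by (simp add: zero_le_mult_iff)
  qed
  then show ?thesis unfolding a_def[symmetric] b_def[symmetric] c_def[symmetric]
    by (simp add: real_le_rsqrt)
qed

section \<open>Minima over blocks of i.i.d. variables\<close>

text \<open>Index sets are arbitrary rather than intervals, because the induction below deletes any
  single index from a block.\<close>

locale iid_reals = prob_space M for M :: "'a measure" +
  fixes X :: "'i \<Rightarrow> 'a \<Rightarrow> real" and I :: "'i set" and D :: "real measure"
  assumes indep: "indep_vars (\<lambda>_. borel) X I"
    and distr_X: "i \<in> I \<Longrightarrow> distr M borel (X i) = D"
begin

text \<open>Nonemptiness keeps the minimum in \<open>U\<close> meaningful.\<close>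

definition block :: "'i set \<Rightarrow> bool" where
  "block S \<longleftrightarrow> finite S \<and> S \<noteq> {} \<and> S \<subseteq> I"

definition U :: "'i set \<Rightarrow> 'a \<Rightarrow> real" where
  "U S \<omega> = (MIN i\<in>S. X i \<omega>)"

definition L2 :: "'i set \<Rightarrow> (real \<Rightarrow> real) \<Rightarrow> bool" where
  "L2 S \<phi> \<longleftrightarrow> \<phi> \<in> borel_measurable borel \<and> integrable M (\<lambda>\<omega>. (\<phi> (U S \<omega>))\<^sup>2)"

text \<open>\<open>T \<phi> (U S)\<close> is the conditional expectation of \<open>\<phi> (U (insert i S))\<close> given \<open>X j\<close> for \<open>j \<in> S\<close>,
  whenever \<open>i \<notin> S\<close>.\<close>

definition T :: "(real \<Rightarrow> real) \<Rightarrow> real \<Rightarrow> real" where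
  "T \<phi> w = (\<integral>x. \<phi> (min w x) \<partial>D)"

lemma measurable_X: "i \<in> I \<Longrightarrow> X i \<in> borel_measurable M"
  using indep by (auto simp: indep_vars_def)

lemma measurable_U[measurable]: "block S \<Longrightarrow> U S \<in> borel_measurable M"
  unfolding block_def U_def[abs_def] by (intro borel_measurable_Min) (auto intro: measurable_X)

lemma U_insert: "block S \<Longrightarrow> U (insert i S) \<omega> = min (U S \<omega>) (X i \<omega>)"
  by (auto simp: block_def U_def min.commute)

lemma U_singleton: "U {i} = X i"
  by (simp add: U_def[abs_def])

lemma real_distribution_D: "i \<in> I \<Longrightarrow> real_distribution D"
  using distr_X measurable_X real_distribution_distr by metis

text \<open>The minimum exceeds \<open>t\<close> exactly when all variables of the block do, so
  independence multiplies the tails.\<close>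

lemma prob_U_greater:
  assumes S: "block S"
  shows "prob {\<omega>\<in>space M. t < U S \<omega>} = (1 - cdf D t) ^ card S"
proof -
  have fin: "finite S" "S \<noteq> {}" "S \<subseteq> I" using S by (auto simp: block_def)
  have "{\<omega>\<in>space M. t < U S \<omega>} = (\<Inter>i\<in>S. X i -` {t<..} \<inter> space M)"
    using fin by (auto simp: U_def)
  then have "prob {\<omega>\<in>space M. t < U S \<omega>} = (\<Prod>i\<in>S. prob (X i -` {t<..} \<inter> space M))"
    using indep_varsD[OF indep fin(2,1,3), of "\<lambda>_. {t<..}"] by simp
  also have "\<dots> = (\<Prod>i\<in>S. 1 - cdf D t)"
  proof (rule prod.cong[OF refl])
    fix i assume "i \<in> S"
    then have i: "i \<in> I" using fin by auto
    interpret D: real_distribution D by (rule real_distribution_D[OF i])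
    have "prob (X i -` {t<..} \<inter> space M) = measure (distr M borel (X i)) {t<..}"
      using measurable_X[OF i] by (subst measure_distr) auto
    also have "\<dots> = measure D (space D - {..t})"
    proof -
      have "{t<..} = UNIV - {..t}" by auto
      then show ?thesis by (simp only: D.space_eq_univ distr_X[OF i])
    qed
    also have "\<dots> = 1 - cdf D t"
      by (subst D.prob_compl) (auto simp: cdf_def)
    finally show "prob (X i -` {t<..} \<inter> space M) = 1 - cdf D t" .
  qed
  finally show ?thesis by simp
qed

text \<open>The cdf of a minimum depends on the block only through its size. This is the symmetry
  that later gives all one-variable deletions the same second moment.\<close>

lemma distr_U_cong:
  assumes S: "block S" and S': "block S'" and card: "card S = card S'"
  shows "distr M borel (U S) = distr M borel (U S')"
proof (rule cdf_unique)
  note [measurable] = measurable_U[OF S] measurable_U[OF S']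
  show "real_distribution (distr M borel (U S))" "real_distribution (distr M borel (U S'))"
    by auto
  have *: "cdf (distr M borel (U R)) t = 1 - (1 - cdf D t) ^ card R" if R: "block R" for R t
  proof -
    note [measurable] = measurable_U[OF R]
    have "cdf (distr M borel (U R)) t = prob (space M - {\<omega>\<in>space M. t < U R \<omega>})"
      unfolding cdf_def by (subst measure_distr) (auto intro!: arg_cong[where f=prob])
    also have "\<dots> = 1 - prob {\<omega>\<in>space M. t < U R \<omega>}"
      by (rule prob_compl) simp
    finally show ?thesis by (simp add: prob_U_greater[OF R])
  qed
  show "cdf (distr M borel (U S)) = cdf (distr M borel (U S'))"
    using *[OF S] *[OF S'] card by auto
qed

lemma expectation_U_cong:
  fixes f :: "real \<Rightarrow> real"
  assumes S: "block S" and S': "block S'" and card: "card S = card S'"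
    and f[measurable]: "f \<in> borel_measurable borel"
  shows "expectation (\<lambda>\<omega>. f (U S \<omega>)) = expectation (\<lambda>\<omega>. f (U S' \<omega>))"
proof -
  note [measurable] = measurable_U[OF S] measurable_U[OF S']
  have "expectation (\<lambda>\<omega>. f (U S \<omega>)) = integral\<^sup>L (distr M borel (U S)) f"
    by (simp add: integral_distr)
  also have "\<dots> = expectation (\<lambda>\<omega>. f (U S' \<omega>))"
    unfolding distr_U_cong[OF S S' card] by (simp add: integral_distr)
  finally show ?thesis .
qed

lemma L2_measurable: "L2 S \<phi> \<Longrightarrow> \<phi> \<in> borel_measurable borel"
  by (simp add: L2_def)

lemma L2_square_integrable: "L2 S \<phi> \<Longrightarrow> integrable M (\<lambda>\<omega>. (\<phi> (U S \<omega>))\<^sup>2)"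
  by (simp add: L2_def)

lemma L2_measurable_U: "L2 S \<phi> \<Longrightarrow> block S \<Longrightarrow> (\<lambda>\<omega>. \<phi> (U S \<omega>)) \<in> borel_measurable M"
  using measurable_U[of S] by (auto simp: L2_def)

lemma L2_integrable: "L2 S \<phi> \<Longrightarrow> block S \<Longrightarrow> integrable M (\<lambda>\<omega>. \<phi> (U S \<omega>))"
  by (rule square_integrable_imp_integrable[OF L2_measurable_U L2_square_integrable])

lemma L2_integrable_mult:
  "L2 S \<phi> \<Longrightarrow> block S \<Longrightarrow> L2 S' \<psi> \<Longrightarrow> block S' \<Longrightarrow>
    integrable M (\<lambda>\<omega>. \<phi> (U S \<omega>) * \<psi> (U S' \<omega>))"
  by (rule square_integrable_imp_integrable_mult)
    (auto intro: L2_measurable_U L2_square_integrable)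

section \<open>Integrating out one variable\<close>

text \<open>The blocks may overlap, so their minima may be dependent. It suffices that both are
  functions of the vector of \<open>X j\<close> with \<open>j \<in> S \<union> S'\<close>, which is
  independent of \<open>X i\<close>.\<close>

lemma Fubini_X:
  fixes H :: "real \<times> real \<Rightarrow> real \<Rightarrow> real"
  assumes S: "block S" and S': "block S'" and i: "i \<in> I" "i \<notin> S" "i \<notin> S'"
    and H[measurable]: "case_prod H \<in> borel_measurable ((borel \<Otimes>\<^sub>M borel) \<Otimes>\<^sub>M borel)"
    and int: "integrable M (\<lambda>\<omega>. H (U S \<omega>, U S' \<omega>) (X i \<omega>))"
  shows "AE \<omega> in M. integrable D (H (U S \<omega>, U S' \<omega>))"
    and "integrable M (\<lambda>\<omega>. \<integral>x. H (U S \<omega>, U S' \<omega>) x \<partial>D)"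
    and "expectation (\<lambda>\<omega>. H (U S \<omega>, U S' \<omega>) (X i \<omega>)) = expectation (\<lambda>\<omega>. \<integral>x. H (U S \<omega>, U S' \<omega>) x \<partial>D)"
proof -
  let ?R = "S \<union> S'"
  have fin: "finite S" "finite S'" "?R \<subseteq> I" using S S' by (auto simp: block_def)
  \<comment> \<open>\<open>G\<close> is \<open>H\<close> rewritten as a function of two coordinate
    vectors, the form in which \<open>indep_var_restrict\<close> supplies independence.\<close>
  define G where "G = (\<lambda>p::('i \<Rightarrow> real) \<times> ('i \<Rightarrow> real). H (Min (fst p ` S), Min (fst p ` S')) (snd p i))"
  have [measurable]: "(\<lambda>f. Min (f ` S)) \<in> borel_measurable (PiM ?R (\<lambda>_. borel :: real measure))"
    "(\<lambda>f. Min (f ` S')) \<in> borel_measurable (PiM ?R (\<lambda>_. borel :: real measure))"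
    using fin by (auto intro!: borel_measurable_Min)
  have G: "G \<in> borel_measurable (PiM ?R (\<lambda>_. borel) \<Otimes>\<^sub>M PiM {i} (\<lambda>_. borel))"
    unfolding G_def by measurable
  have G_eq: "G (restrict (\<lambda>j. X j \<omega>) ?R, restrict (\<lambda>j. X j \<omega>') {i}) = H (U S \<omega>, U S' \<omega>) (X i \<omega>')"
    for \<omega> \<omega>'
    by (auto simp: G_def U_def intro!: arg_cong2[where f=H] arg_cong[where f=Min])
  note F = indep_var_Fubini[OF indep_var_restrict[OF indep, of ?R "{i}"] G, unfolded G_eq]
  have Hz: "H z \<in> borel_measurable borel" for z
    using measurable_Pair2[OF H, of z] by (simp only: split_conv) (simp add: space_pair_measure)
  have D: "integrable M (\<lambda>\<omega>. H z (X i \<omega>)) \<longleftrightarrow> integrable D (H z)"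
    "expectation (\<lambda>\<omega>. H z (X i \<omega>)) = (\<integral>x. H z x \<partial>D)" for z
    using integrable_distr_eq[OF measurable_X[OF i(1)] Hz] integral_distr[OF measurable_X[OF i(1)] Hz]
    by (simp_all add: distr_X[OF i(1)])
  show "AE \<omega> in M. integrable D (H (U S \<omega>, U S' \<omega>))"
    "integrable M (\<lambda>\<omega>. \<integral>x. H (U S \<omega>, U S' \<omega>) x \<partial>D)"
    "expectation (\<lambda>\<omega>. H (U S \<omega>, U S' \<omega>) (X i \<omega>)) = expectation (\<lambda>\<omega>. \<integral>x. H (U S \<omega>, U S' \<omega>) x \<partial>D)"
    using F fin i int by (simp_all add: D)
qed

lemma measurable_T:
  assumes "i \<in> I" and [measurable]: "\<phi> \<in> borel_measurable borel"
  shows "T \<phi> \<in> borel_measurable borel"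
proof -
  interpret D: real_distribution D by (rule real_distribution_D) fact
  show ?thesis unfolding T_def[abs_def] by measurable
qed

text \<open>By Jensen, \<open>(T \<phi> w)^2\<close> is at most the \<open>D\<close>-integral of
  \<open>(\<phi> (min w x))^2\<close> over \<open>x\<close>, for almost every value \<open>w\<close>
  of \<open>U S\<close>; by Fubini this bound is integrable.\<close>

lemma L2_T:
  assumes S: "block S" and i: "i \<in> I" "i \<notin> S" and \<phi>: "L2 (insert i S) \<phi>"
  shows "L2 S (T \<phi>)"
proof -
  interpret D: real_distribution D by (rule real_distribution_D) fact
  note [measurable] = measurable_U[OF S] L2_measurable[OF \<phi>] measurable_T[OF i(1) L2_measurable[OF \<phi>]]
  let ?H = "\<lambda>(p::real \<times> real) x. (\<phi> (min (fst p) x))\<^sup>2"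
  have "integrable M (\<lambda>\<omega>. ?H (U S \<omega>, U S \<omega>) (X i \<omega>))"
    using L2_square_integrable[OF \<phi>] by (simp add: U_insert[OF S])
  note F = Fubini_X[OF S S i(1) i(2) i(2) _ this]
  have F1: "AE \<omega> in M. integrable D (\<lambda>y. (\<phi> (min (U S \<omega>) y))\<^sup>2)"
    and F2: "integrable M (\<lambda>\<omega>. \<integral>y. (\<phi> (min (U S \<omega>) y))\<^sup>2 \<partial>D)"
    using F(1,2) by simp_all
  have "integrable M (\<lambda>\<omega>. (T \<phi> (U S \<omega>))\<^sup>2)"
  proof (rule Bochner_Integration.integrable_bound[OF F2])
    show "AE \<omega> in M. norm ((T \<phi> (U S \<omega>))\<^sup>2) \<le> norm (\<integral>y. (\<phi> (min (U S \<omega>) y))\<^sup>2 \<partial>D)"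
      using F1
    proof eventually_elim
      case (elim \<omega>)
      let ?f = "\<lambda>y. \<phi> (min (U S \<omega>) y)"
      have "integrable D ?f" by (rule D.square_integrable_imp_integrable[OF _ elim]) simp
      \<comment> \<open>Jensen's inequality for the square is nonnegativity of the variance of
        \<open>?f\<close> under \<open>D\<close>.\<close>
      with elim D.variance_eq[of ?f] D.variance_positive[of ?f]
      show ?case by (simp add: T_def)
    qed
  qed simp
  then show ?thesis by (simp add: L2_def)
qed

text \<open>As \<open>\<psi> (U S')\<close> does not involve \<open>X i\<close>, integrating over
  \<open>X i\<close> first acts on the other factor alone. \<open>S' = S\<close> gives the
  projection property; other choices of \<open>S'\<close> supply the conditional
  independence.\<close>

lemma expectation_T_mult:
  assumes S: "block S" and i: "i \<in> I" "i \<notin> S" and \<phi>: "L2 (insert i S) \<phi>"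
    and S': "block S'" "i \<notin> S'" and \<psi>: "L2 S' \<psi>"
  shows "expectation (\<lambda>\<omega>. \<phi> (U (insert i S) \<omega>) * \<psi> (U S' \<omega>))
    = expectation (\<lambda>\<omega>. T \<phi> (U S \<omega>) * \<psi> (U S' \<omega>))"
proof -
  interpret D: real_distribution D by (rule real_distribution_D) fact
  note [measurable] = L2_measurable[OF \<phi>] L2_measurable[OF \<psi>]
  have ins: "block (insert i S)" using S i by (auto simp: block_def)
  let ?H = "\<lambda>(p::real \<times> real) x. \<phi> (min (fst p) x) * \<psi> (snd p)"
  have "integrable M (\<lambda>\<omega>. ?H (U S \<omega>, U S' \<omega>) (X i \<omega>))"
    using L2_integrable_mult[OF \<phi> ins \<psi> S'(1)] by (simp add: U_insert[OF S])
  note F = Fubini_X(3)[OF S S'(1) i(1) i(2) S'(2) _ this]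
  show ?thesis
    using F by (simp add: U_insert[OF S] T_def)
qed

lemma expectation_T:
  assumes S: "block S" and i: "i \<in> I" "i \<notin> S" and \<phi>: "L2 (insert i S) \<phi>"
  shows "expectation (\<lambda>\<omega>. T \<phi> (U S \<omega>)) = expectation (\<lambda>\<omega>. \<phi> (U (insert i S) \<omega>))"
  using expectation_T_mult[OF S i \<phi> S i(2), of "\<lambda>_. 1"] by (simp add: L2_def)

section \<open>Contraction of second moments and the upper bound\<close>

text \<open>The condition \<open>1 \<le> k\<close> keeps \<open>A - {i}\<close> nonempty. The
  induction varies \<open>\<phi>\<close> and \<open>A\<close>, since its hypothesis is applied to
  \<open>T \<phi>\<close> on \<open>A - {j}\<close>.\<close>

lemma T_contraction:
  assumes "block A" "card A = Suc k" "1 \<le> k" "i \<in> A" "L2 A \<phi>"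
    and "expectation (\<lambda>\<omega>. \<phi> (U A \<omega>)) = 0"
  shows "real (Suc k) * expectation (\<lambda>\<omega>. (T \<phi> (U (A - {i}) \<omega>))\<^sup>2)
    \<le> real k * expectation (\<lambda>\<omega>. (\<phi> (U A \<omega>))\<^sup>2)"
  using assms
proof (induction k arbitrary: A i \<phi>)
  case 0
  then show ?case by simp
next
  case (Suc k A i \<phi>)
  note A = \<open>block A\<close> and \<phi> = \<open>L2 A \<phi>\<close>
  have fin: "finite A" "A \<subseteq> I" using A by (auto simp: block_def)
  have cardA: "card A = Suc (Suc k)" by fact
  \<comment> \<open>\<open>K\<close> is the size of each \<open>A - {j}\<close>, so \<open>A\<close>
    has \<open>K + 1\<close> elements and the goal is \<open>(K + 1) * v \<le> K * E\<close>, where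
    \<open>E\<close> is the second moment of \<open>\<phi> (U A)\<close>.\<close>
  define K where "K = real (Suc k)"
  have K: "0 < K" "K \<noteq> 0" by (simp_all add: K_def)
  define g where "g j \<omega> = T \<phi> (U (A - {j}) \<omega>)" for j \<omega>
  define v where "v = expectation (\<lambda>\<omega>. (g i \<omega>)\<^sup>2)"
  have del: "block (A - {j})" "j \<in> I" "insert j (A - {j}) = A" "card (A - {j}) = Suc k"
      "L2 (A - {j}) (T \<phi>)" "expectation (g j) = 0" if "j \<in> A" for j
  proof -
    show c: "card (A - {j}) = Suc k" using that fin cardA by simp
    then have "A - {j} \<noteq> {}" by (metis card.empty nat.distinct(1))
    then show b: "block (A - {j})" using A by (auto simp: block_def)
    show j: "j \<in> I" and i: "insert j (A - {j}) = A" using that fin by auto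
    show "L2 (A - {j}) (T \<phi>)" using L2_T[OF b j] \<phi> i by simp
    have "expectation (\<lambda>\<omega>. T \<phi> (U (A - {j}) \<omega>)) = 0"
      using expectation_T[OF b j, of \<phi>] \<phi> i Suc.prems(6) by simp
    then show "expectation (g j) = 0" by (simp add: g_def[abs_def])
  qed
  have g_square: "expectation (\<lambda>\<omega>. (g j \<omega>)\<^sup>2) = v" if j: "j \<in> A" for j
    unfolding v_def g_def
    using expectation_U_cong[OF del(1)[OF j] del(1)[OF Suc.prems(4)], of "\<lambda>x. (T \<phi> x)\<^sup>2"]
      del(4)[OF j] del(4)[OF Suc.prems(4)] L2_measurable[OF del(5)[OF j]] by simp
  \<comment> \<open>The projection property, tested against \<open>g j\<close> itself.\<close>
  have f_g: "expectation (\<lambda>\<omega>. \<phi> (U A \<omega>) * g j \<omega>) = v" if j: "j \<in> A" for j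
    using expectation_T_mult[OF del(1,2)[OF j] _ _ del(1)[OF j] _ del(5)[OF j], of \<phi>]
      \<phi> del(3)[OF j] g_square[OF j] by (simp add: g_def power2_eq_square)
  have g_g: "expectation (\<lambda>\<omega>. g j \<omega> * g j' \<omega>) \<le> real k / K * v"
    if j: "j \<in> A" and j': "j' \<in> A" and ne: "j \<noteq> j'" for j j'
  proof (cases "k = 0")
    \<comment> \<open>The true base case: with two variables, \<open>g j\<close> and
      \<open>g j'\<close> depend on one variable each, hence are independent with mean zero, and the
      bound is 0.\<close>
    case True
    have "A = {j, j'}"
      using card_subset_eq[of A "{j, j'}"] fin j j' ne cardA True by auto
    then have Aj: "A - {j} = {j'}" "A - {j'} = {j}" using ne by auto
    have "indep_vars (\<lambda>_. borel) X (insert j' {j})"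
      using indep_vars_subset[OF indep, of "{j', j}"] j j' fin by auto
    from indep_vars_Min[OF _ _ this] ne have "indep_var borel (X j') borel (X j)" by simp
    from indep_var_compose[OF this, of "T \<phi>" borel "T \<phi>" borel]
    have ind: "indep_var borel (g j) borel (g j')"
      using L2_measurable[OF del(5)[OF j]]
      by (simp add: g_def[abs_def] Aj U_singleton comp_def)
    have "integrable M (g j)" "integrable M (g j')"
      using L2_integrable del(1,5) j j' by (auto simp: g_def[abs_def])
    from indep_var_lebesgue_integral[OF ind this] del(6)[OF j]
    show ?thesis using True by simp
  next
    case False
    let ?S = "A - {j} - {j'}"
    have c: "card ?S = k" using del(4)[OF j] j' ne fin by simp
    then have "?S \<noteq> {}" using False by (metis card.empty)
    then have S: "block ?S" using del(1)[OF j] by (auto simp: block_def)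
    have ins: "insert j' ?S = A - {j}" "insert j ?S = A - {j'}" using j j' ne by auto
    have L: "L2 ?S (T (T \<phi>))" using L2_T[OF S del(2)[OF j']] del(5)[OF j] ins(1) by simp
    \<comment> \<open>Integrating out \<open>X j'\<close> turns the first factor into
      \<open>T (T \<phi>) (U ?S)\<close>; integrating out \<open>X j\<close> then does the same to
      the second. The induction hypothesis for \<open>T \<phi>\<close> on \<open>A - {j}\<close>
      bounds the resulting second moment.\<close>
    have "expectation (\<lambda>\<omega>. g j \<omega> * g j' \<omega>)
        = expectation (\<lambda>\<omega>. T (T \<phi>) (U ?S \<omega>) * T \<phi> (U (A - {j'}) \<omega>))"
      using expectation_T_mult[OF S del(2)[OF j'] _ _ del(1)[OF j'] _ del(5)[OF j'], of "T \<phi>"]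
        del(5)[OF j] ins(1) by (simp add: g_def)
    also have "\<dots> = expectation (\<lambda>\<omega>. (T (T \<phi>) (U ?S \<omega>))\<^sup>2)"
      using expectation_T_mult[OF S del(2)[OF j] _ _ S _ L, of "T \<phi>"]
        del(5)[OF j'] ins(2) by (simp add: power2_eq_square mult.commute)
    finally have "K * expectation (\<lambda>\<omega>. g j \<omega> * g j' \<omega>) \<le> real k * v"
      using Suc.IH[OF del(1,4)[OF j] _ _ del(5)[OF j], of j'] False j' ne del(6)[OF j] g_square[OF j]
      by (simp add: g_def[abs_def] K_def)
    then show ?thesis using K by (simp add: field_simps)
  qed
  have int: "integrable M (\<lambda>\<omega>. (\<phi> (U A \<omega>))\<^sup>2)"
    "\<And>j. j \<in> A \<Longrightarrow> integrable M (\<lambda>\<omega>. \<phi> (U A \<omega>) * g j \<omega>)"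
    "\<And>j j'. j \<in> A \<Longrightarrow> j' \<in> A \<Longrightarrow> integrable M (\<lambda>\<omega>. g j \<omega> * g j' \<omega>)"
    unfolding g_def using \<phi> A del(1,5) by (blast intro: L2_square_integrable L2_integrable_mult)+
  \<comment> \<open>\<open>1 / K\<close> minimises the resulting upper bound, a quadratic in the coefficient of the sum.\<close>
  let ?c = "1 / K"
  have "0 \<le> expectation (\<lambda>\<omega>. (\<phi> (U A \<omega>) - ?c * (\<Sum>j\<in>A. g j \<omega>))\<^sup>2)"
    by simp
  also have "(\<lambda>\<omega>. (\<phi> (U A \<omega>) - ?c * (\<Sum>j\<in>A. g j \<omega>))\<^sup>2) = (\<lambda>\<omega>. (\<phi> (U A \<omega>))\<^sup>2
      - 2 * ?c * (\<Sum>j\<in>A. \<phi> (U A \<omega>) * g j \<omega>) + ?c\<^sup>2 * (\<Sum>j\<in>A. \<Sum>j'\<in>A. g j \<omega> * g j' \<omega>))"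
    unfolding sum_distrib_left[symmetric] sum_distrib_right[symmetric]
    by (simp add: power2_diff power_mult_distrib power2_eq_square fun_eq_iff algebra_simps)
  also have "expectation \<dots> = expectation (\<lambda>\<omega>. (\<phi> (U A \<omega>))\<^sup>2)
      - 2 * ?c * (\<Sum>j\<in>A. v) + ?c\<^sup>2 * (\<Sum>j\<in>A. \<Sum>j'\<in>A. expectation (\<lambda>\<omega>. g j \<omega> * g j' \<omega>))"
    using int f_g by simp
  also have "\<dots> \<le> expectation (\<lambda>\<omega>. (\<phi> (U A \<omega>))\<^sup>2) - 2 * ?c * (\<Sum>j\<in>A. v) + ?c\<^sup>2 * (\<Sum>j\<in>A. K * v)"
  proof (intro add_left_mono mult_left_mono sum_mono)
    fix j assume j: "j \<in> A"
    have "(\<Sum>j'\<in>A. expectation (\<lambda>\<omega>. g j \<omega> * g j' \<omega>))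
        = v + (\<Sum>j'\<in>A - {j}. expectation (\<lambda>\<omega>. g j \<omega> * g j' \<omega>))"
      using sum.remove[OF fin(1) j, of "\<lambda>j'. expectation (\<lambda>\<omega>. g j \<omega> * g j' \<omega>)"] g_square[OF j]
      by (simp add: power2_eq_square)
    \<comment> \<open>The diagonal term is \<open>v\<close>; the \<open>K\<close> others contribute
      at most \<open>k / K * v\<close> each, and \<open>v + k * v = K * v\<close>.\<close>
    also have "\<dots> \<le> v + (\<Sum>j'\<in>A - {j}. real k / K * v)"
      using j by (intro add_left_mono sum_mono g_g) auto
    also have "\<dots> = K * v"
    proof -
      have "v + K * (real k / K * v) = v + real k * v" using K(2) by simp
      then show ?thesis using del(4)[OF j] by (simp add: K_def distrib_right)
    qed
    finally show "(\<Sum>j'\<in>A. expectation (\<lambda>\<omega>. g j \<omega> * g j' \<omega>)) \<le> K * v" .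
  qed simp
  \<comment> \<open>Since \<open>A\<close> has \<open>K + 1\<close> elements, the linear term is
    \<open>-2 * (K + 1) * v / K\<close> and the quadratic one
    \<open>(K + 1) * v / K\<close>.\<close>
  also have "\<dots> = expectation (\<lambda>\<omega>. (\<phi> (U A \<omega>))\<^sup>2) - (K + 1) * v / K"
    using K(2) by (simp add: cardA K_def[symmetric] field_simps power2_eq_square)
      (simp add: K_def algebra_simps)
  finally have "(K + 1) * v \<le> K * expectation (\<lambda>\<omega>. (\<phi> (U A \<omega>))\<^sup>2)"
    using K(1) by (simp add: field_simps)
  then show ?case by (simp add: K_def v_def g_def algebra_simps)
qed

text \<open>The variables of \<open>P\<close> are integrated out one at a time, and the factors
  \<open>k / (k + 1)\<close> telescope. The witness is an iterate of \<open>T\<close> on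
  \<open>\<phi>\<close>; the last conjunct keeps all that is needed of it, its pairing with
  functions of variables outside \<open>P\<close>.\<close>

lemma reduce_block:
  assumes "finite P" "block C" "P \<inter> C = {}" "P \<subseteq> I" "L2 (P \<union> C) \<phi>"
    and "expectation (\<lambda>\<omega>. \<phi> (U (P \<union> C) \<omega>)) = 0"
  shows "\<exists>\<phi>'. L2 C \<phi>' \<and>
    real (card (P \<union> C)) * expectation (\<lambda>\<omega>. (\<phi>' (U C \<omega>))\<^sup>2)
      \<le> real (card C) * expectation (\<lambda>\<omega>. (\<phi> (U (P \<union> C) \<omega>))\<^sup>2) \<and>
    (\<forall>B \<psi>. block B \<longrightarrow> P \<inter> B = {} \<longrightarrow> L2 B \<psi> \<longrightarrow>
      expectation (\<lambda>\<omega>. \<phi> (U (P \<union> C) \<omega>) * \<psi> (U B \<omega>)) = expectation (\<lambda>\<omega>. \<phi>' (U C \<omega>) * \<psi> (U B \<omega>)))"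
  using assms
proof (induction P arbitrary: \<phi> rule: finite_induct)
  case empty
  then show ?case by (intro exI[of _ \<phi>]) auto
next
  case (insert p P \<phi>)
  let ?S = "P \<union> C"
  have p: "p \<in> I" "p \<notin> ?S" using insert by auto
  have S: "block ?S" using insert by (auto simp: block_def)
  have ins: "insert p P \<union> C = insert p ?S" by simp
  have A: "block (insert p ?S)" using S p by (auto simp: block_def)
  have \<phi>: "L2 (insert p ?S) \<phi>" using insert.prems by simp
  have L: "L2 ?S (T \<phi>)" by (rule L2_T[OF S p \<phi>])
  have mean: "expectation (\<lambda>\<omega>. T \<phi> (U ?S \<omega>)) = 0"
    using expectation_T[OF S p \<phi>] insert.prems by simp
  obtain \<phi>' where \<phi>': "L2 C \<phi>'"
    and le: "real (card ?S) * expectation (\<lambda>\<omega>. (\<phi>' (U C \<omega>))\<^sup>2)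
      \<le> real (card C) * expectation (\<lambda>\<omega>. (T \<phi> (U ?S \<omega>))\<^sup>2)"
    and eq: "\<And>B \<psi>. block B \<Longrightarrow> P \<inter> B = {} \<Longrightarrow> L2 B \<psi> \<Longrightarrow>
      expectation (\<lambda>\<omega>. T \<phi> (U ?S \<omega>) * \<psi> (U B \<omega>)) = expectation (\<lambda>\<omega>. \<phi>' (U C \<omega>) * \<psi> (U B \<omega>))"
    using insert.IH[OF insert.prems(1) _ _ L mean] insert.prems by blast
  define c where "c = card ?S"
  have c: "1 \<le> c" using S by (auto simp: c_def block_def Suc_le_eq card_gt_0_iff)
  have cS: "card (insert p ?S) = Suc c" using S p by (simp add: c_def block_def)
  have "real (Suc c) * expectation (\<lambda>\<omega>. (T \<phi> (U ?S \<omega>))\<^sup>2)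
      \<le> real c * expectation (\<lambda>\<omega>. (\<phi> (U (insert p ?S) \<omega>))\<^sup>2)"
    using T_contraction[OF A cS c, of p \<phi>] p \<phi> insert.prems(5) by simp
  \<comment> \<open>Both estimates are scaled to share a middle term; the common factor
    \<open>c\<close>, positive since \<open>?S\<close> is nonempty, then cancels.\<close>
  then have "real (card C) * (real (Suc c) * expectation (\<lambda>\<omega>. (T \<phi> (U ?S \<omega>))\<^sup>2))
      \<le> real (card C) * (real c * expectation (\<lambda>\<omega>. (\<phi> (U (insert p ?S) \<omega>))\<^sup>2))"
    by (rule mult_left_mono) simp
  moreover have "real (Suc c) * (real c * expectation (\<lambda>\<omega>. (\<phi>' (U C \<omega>))\<^sup>2))
      \<le> real (Suc c) * (real (card C) * expectation (\<lambda>\<omega>. (T \<phi> (U ?S \<omega>))\<^sup>2))"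
    using le by (intro mult_left_mono) (simp_all add: c_def)
  ultimately have "real c * (real (Suc c) * expectation (\<lambda>\<omega>. (\<phi>' (U C \<omega>))\<^sup>2))
      \<le> real c * (real (card C) * expectation (\<lambda>\<omega>. (\<phi> (U (insert p ?S) \<omega>))\<^sup>2))"
    by (simp only: mult.left_commute)
  then have "real (Suc c) * expectation (\<lambda>\<omega>. (\<phi>' (U C \<omega>))\<^sup>2)
      \<le> real (card C) * expectation (\<lambda>\<omega>. (\<phi> (U (insert p ?S) \<omega>))\<^sup>2)"
    using c by (simp only: mult_le_cancel_left_pos of_nat_0_less_iff)
  moreover have "expectation (\<lambda>\<omega>. \<phi> (U (insert p ?S) \<omega>) * \<psi> (U B \<omega>))
      = expectation (\<lambda>\<omega>. \<phi>' (U C \<omega>) * \<psi> (U B \<omega>))"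
    if "block B" "insert p P \<inter> B = {}" "L2 B \<psi>" for B \<psi>
    using expectation_T_mult[OF S p \<phi> that(1) _ that(3)] eq[OF that(1) _ that(3)] that(2) by auto
  ultimately show ?case unfolding ins cS using \<phi>' by blast
qed

text \<open>The reductions are made in turn: \<open>A - B\<close> is removed while pairing with
  \<open>B\<close>, then \<open>B - A\<close> while pairing with \<open>A \<inter> B\<close>, where
  the first function already lives.\<close>

lemma expectation_mult_le:
  assumes A: "block A" and B: "block B" and C: "A \<inter> B \<noteq> {}"
    and \<phi>: "L2 A \<phi>" "expectation (\<lambda>\<omega>. \<phi> (U A \<omega>)) = 0"
    and \<psi>: "L2 B \<psi>" "expectation (\<lambda>\<omega>. \<psi> (U B \<omega>)) = 0"
  shows "expectation (\<lambda>\<omega>. \<phi> (U A \<omega>) * \<psi> (U B \<omega>))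
    \<le> real (card (A \<inter> B)) / sqrt (real (card A) * real (card B)) *
      sqrt (expectation (\<lambda>\<omega>. (\<phi> (U A \<omega>))\<^sup>2) * expectation (\<lambda>\<omega>. (\<psi> (U B \<omega>))\<^sup>2))"
proof -
  let ?C = "A \<inter> B"
  have C: "block ?C" using A B C by (auto simp: block_def)
  have un: "(A - ?C) \<union> ?C = A" "(B - ?C) \<union> ?C = B" by auto
  have side: "finite (A - ?C)" "finite (B - ?C)" "(A - ?C) \<inter> ?C = {}" "(B - ?C) \<inter> ?C = {}"
    "A - ?C \<subseteq> I" "B - ?C \<subseteq> I" "(A - ?C) \<inter> B = {}"
    using A B by (auto simp: block_def)
  obtain \<phi>' where \<phi>': "L2 ?C \<phi>'"
    and le1: "real (card A) * expectation (\<lambda>\<omega>. (\<phi>' (U ?C \<omega>))\<^sup>2)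
      \<le> real (card ?C) * expectation (\<lambda>\<omega>. (\<phi> (U A \<omega>))\<^sup>2)"
    and eq1: "\<And>\<psi>. L2 B \<psi> \<Longrightarrow> expectation (\<lambda>\<omega>. \<phi> (U A \<omega>) * \<psi> (U B \<omega>)) = expectation (\<lambda>\<omega>. \<phi>' (U ?C \<omega>) * \<psi> (U B \<omega>))"
    using reduce_block[OF side(1) C side(3,5), of \<phi>, unfolded un] \<phi> B side(7) by blast
  obtain \<psi>' where \<psi>': "L2 ?C \<psi>'"
    and le2: "real (card B) * expectation (\<lambda>\<omega>. (\<psi>' (U ?C \<omega>))\<^sup>2)
      \<le> real (card ?C) * expectation (\<lambda>\<omega>. (\<psi> (U B \<omega>))\<^sup>2)"
    and eq2: "\<And>\<phi>. L2 ?C \<phi> \<Longrightarrow> expectation (\<lambda>\<omega>. \<psi> (U B \<omega>) * \<phi> (U ?C \<omega>)) = expectation (\<lambda>\<omega>. \<psi>' (U ?C \<omega>) * \<phi> (U ?C \<omega>))"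
    using reduce_block[OF side(2) C side(4,6), of \<psi>, unfolded un] \<psi> C side(4) by blast
  define a b c where "a = real (card A)" and "b = real (card B)" and "c = real (card ?C)"
  have pos: "0 < a" "0 < b" "0 < c"
    using A B C by (auto simp: a_def b_def c_def block_def card_gt_0_iff)
  have "expectation (\<lambda>\<omega>. \<phi> (U A \<omega>) * \<psi> (U B \<omega>)) = expectation (\<lambda>\<omega>. \<psi>' (U ?C \<omega>) * \<phi>' (U ?C \<omega>))"
    using eq1[OF \<psi>(1)] eq2[OF \<phi>'] by (simp add: mult.commute)
  also have "\<dots> \<le> sqrt (expectation (\<lambda>\<omega>. (\<psi>' (U ?C \<omega>))\<^sup>2) * expectation (\<lambda>\<omega>. (\<phi>' (U ?C \<omega>))\<^sup>2))"
    by (intro Cauchy_Schwarz_integral L2_measurable_U L2_square_integrable \<phi>' \<psi>' C)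
  \<comment> \<open>The two reductions contribute \<open>c / b\<close> and \<open>c / a\<close>, so
    \<open>c / sqrt (a * b)\<close> comes out of the root.\<close>
  also have "\<dots> \<le> sqrt ((c / b * expectation (\<lambda>\<omega>. (\<psi> (U B \<omega>))\<^sup>2)) * (c / a * expectation (\<lambda>\<omega>. (\<phi> (U A \<omega>))\<^sup>2)))"
    using le1 le2 pos unfolding a_def[symmetric] b_def[symmetric] c_def[symmetric]
    by (intro real_sqrt_le_mono mult_mono) (simp_all add: field_simps)
  also have "\<dots> = sqrt (c\<^sup>2 / (a * b) * (expectation (\<lambda>\<omega>. (\<phi> (U A \<omega>))\<^sup>2) * expectation (\<lambda>\<omega>. (\<psi> (U B \<omega>))\<^sup>2)))"
    by (simp add: power2_eq_square field_simps)
  also have "\<dots> = c / sqrt (a * b) * sqrt (expectation (\<lambda>\<omega>. (\<phi> (U A \<omega>))\<^sup>2) * expectation (\<lambda>\<omega>. (\<psi> (U B \<omega>))\<^sup>2))"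
    using pos by (simp only: real_sqrt_mult[of "c\<^sup>2 / (a * b)"] real_sqrt_divide real_sqrt_abs abs_of_pos)
  finally show ?thesis by (simp only: a_def b_def c_def)
qed

text \<open>Subtracting the means turns covariance and variances into the moments of mean-zero
  functions bounded above.\<close>

lemma correlation_le:
  assumes A: "block A" and B: "block B" and C: "A \<inter> B \<noteq> {}"
    and [measurable]: "\<phi> \<in> borel_measurable borel" "\<psi> \<in> borel_measurable borel"
    and f: "finite_positive_variance (\<lambda>\<omega>. \<phi> (U A \<omega>))"
    and g: "finite_positive_variance (\<lambda>\<omega>. \<psi> (U B \<omega>))"
  shows "covariance (\<lambda>\<omega>. \<phi> (U A \<omega>)) (\<lambda>\<omega>. \<psi> (U B \<omega>)) /
      sqrt (variance (\<lambda>\<omega>. \<phi> (U A \<omega>)) * variance (\<lambda>\<omega>. \<psi> (U B \<omega>)))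
    \<le> real (card (A \<inter> B)) / sqrt (real (card A) * real (card B))"
proof -
  have centre: "L2 S (\<lambda>x. \<eta> x - m) \<and> expectation (\<lambda>\<omega>. \<eta> (U S \<omega>) - m) = 0"
    if S: "block S" and [measurable]: "\<eta> \<in> borel_measurable borel"
      and v: "finite_positive_variance (\<lambda>\<omega>. \<eta> (U S \<omega>))" and m: "m = expectation (\<lambda>\<omega>. \<eta> (U S \<omega>))"
    for S \<eta> m
  proof -
    have sq: "integrable M (\<lambda>\<omega>. (\<eta> (U S \<omega>))\<^sup>2)" using v by (simp add: finite_positive_variance_def)
    then have L: "L2 S \<eta>" by (simp add: L2_def)
    note int = L2_integrable[OF L S]
    have "integrable M (\<lambda>\<omega>. (\<eta> (U S \<omega>) - m)\<^sup>2)"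
      using sq int by (simp add: power2_diff)
    then show ?thesis using int m by (simp add: L2_def prob_space)
  qed
  define \<mu> \<nu> where "\<mu> = expectation (\<lambda>\<omega>. \<phi> (U A \<omega>))" and "\<nu> = expectation (\<lambda>\<omega>. \<psi> (U B \<omega>))"
  have "0 < variance (\<lambda>\<omega>. \<phi> (U A \<omega>)) * variance (\<lambda>\<omega>. \<psi> (U B \<omega>))"
    using f g by (simp add: finite_positive_variance_def)
  then have "0 < sqrt (variance (\<lambda>\<omega>. \<phi> (U A \<omega>)) * variance (\<lambda>\<omega>. \<psi> (U B \<omega>)))"
    by (simp only: real_sqrt_gt_0_iff)
  moreover have "covariance (\<lambda>\<omega>. \<phi> (U A \<omega>)) (\<lambda>\<omega>. \<psi> (U B \<omega>))
    \<le> real (card (A \<inter> B)) / sqrt (real (card A) * real (card B)) *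
      sqrt (variance (\<lambda>\<omega>. \<phi> (U A \<omega>)) * variance (\<lambda>\<omega>. \<psi> (U B \<omega>)))"
    using expectation_mult_le[OF A B C, of "\<lambda>x. \<phi> x - \<mu>" "\<lambda>x. \<psi> x - \<nu>"]
      centre[OF A _ f \<mu>_def] centre[OF B _ g \<nu>_def]
    unfolding covariance_def \<mu>_def[symmetric] \<nu>_def[symmetric] by simp
  ultimately show ?thesis by (simp only: pos_divide_le_eq)
qed

section \<open>Lower bound from indicators of half-lines\<close>

lemma indicator_U:
  assumes S: "block S"
  shows "expectation (\<lambda>\<omega>. indicator {t<..} (U S \<omega>)) = (1 - cdf D t) ^ card S"
    and "integrable M (\<lambda>\<omega>. indicator {t<..} (U S \<omega>) :: real)"
proof -
  note [measurable] = measurable_U[OF S]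
  have eq: "(\<lambda>\<omega>. indicator {t<..} (U S \<omega>) :: real) = indicator {\<omega>. t < U S \<omega>}"
    by (auto simp: indicator_def)
  have "{\<omega>. t < U S \<omega>} \<inter> space M = {\<omega>\<in>space M. t < U S \<omega>}" by auto
  then show "expectation (\<lambda>\<omega>. indicator {t<..} (U S \<omega>)) = (1 - cdf D t) ^ card S"
    unfolding eq by (simp add: prob_U_greater[OF S])
  show "integrable M (\<lambda>\<omega>. indicator {t<..} (U S \<omega>) :: real)"
    by (rule integrable_const_bound[of _ 1]) (auto simp: indicator_def)
qed

text \<open>Indicators are idempotent, and the product of those for \<open>A\<close> and
  \<open>B\<close> is the one for \<open>A \<union> B\<close>, because the minimum over a union is
  the smaller of the two minima.\<close>

lemma indicator_correlation:
  fixes t :: real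
  assumes A: "block A" and B: "block B"
  defines "g \<equiv> 1 - cdf D t"
  defines "f \<equiv> \<lambda>S \<omega>. indicator {t<..} (U S \<omega>) :: real"
  shows "variance (f A) = g ^ card A * (1 - g ^ card A)"
    and "covariance (f A) (f B) = g ^ card (A \<union> B) - g ^ (card A + card B)"
proof -
  have E: "expectation (f S) = g ^ card S" "integrable M (f S)" if "block S" for S
    using indicator_U[OF that, of t] by (simp_all add: f_def g_def)
  have AB: "block (A \<union> B)" using A B by (auto simp: block_def)
  have sq: "(f A \<omega>)\<^sup>2 = f A \<omega>" for \<omega> by (simp add: f_def indicator_def)
  have "variance (f A) = expectation (\<lambda>\<omega>. (f A \<omega>)\<^sup>2) - (expectation (f A))\<^sup>2"
    using E(2)[OF A] by (intro variance_eq) (simp_all add: sq)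
  then show "variance (f A) = g ^ card A * (1 - g ^ card A)"
    unfolding sq E(1)[OF A] by (simp add: power2_eq_square algebra_simps)
  have U: "f A \<omega> * f B \<omega> = f (A \<union> B) \<omega>" for \<omega>
  proof -
    have "U (A \<union> B) \<omega> = min (U A \<omega>) (U B \<omega>)"
      using A B unfolding block_def U_def image_Un by (intro Min_Un) auto
    then show ?thesis by (simp add: f_def indicator_def)
  qed
  have "(\<lambda>\<omega>. (f A \<omega> - expectation (f A)) * (f B \<omega> - expectation (f B)))
      = (\<lambda>\<omega>. f (A \<union> B) \<omega> - expectation (f B) * f A \<omega> - expectation (f A) * f B \<omega>
          + expectation (f A) * expectation (f B))"
    by (simp add: U[symmetric] fun_eq_iff algebra_simps)
  then show "covariance (f A) (f B) = g ^ card (A \<union> B) - g ^ (card A + card B)"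
    using E[OF A] E[OF B] E[OF AB] by (simp add: covariance_def prob_space power_add)
qed

end

text \<open>Here \<open>n\<close> and \<open>c\<close> stand for the sizes of the union and the
  intersection. Numerator and denominator both vanish to first order at 1; cancelling
  \<open>1 - g\<close> leaves a function continuous there.\<close>

lemma indicator_correlation_limit:
  fixes a b c n :: nat
  assumes pos: "0 < a" "0 < b" and n: "a + b = n + c"
  shows "((\<lambda>g::real. (g ^ n - g ^ (a + b)) / sqrt ((g ^ a * (1 - g ^ a)) * (g ^ b * (1 - g ^ b))))
    \<longlongrightarrow> real c / sqrt (real a * real b)) (at_left 1)"
proof -
  \<comment> \<open>The geometric sum is the cofactor of \<open>1 - g\<close> in
    \<open>1 - g ^ k\<close>, and \<open>s k 1 = k\<close> gives the limit.\<close>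
  define s where "s k g = (\<Sum>i<k. g ^ i)" for k and g :: real
  have s: "1 - g ^ k = (1 - g) * s k g" for g k
    by (simp add: s_def one_diff_power_eq)
  have "((\<lambda>g. g ^ n * s c g / sqrt ((g ^ a * s a g) * (g ^ b * s b g)))
      \<longlongrightarrow> 1 ^ n * s c 1 / sqrt ((1 ^ a * s a 1) * (1 ^ b * s b 1))) (at_left 1)"
    unfolding s_def by (intro tendsto_intros) (use pos in auto)
  then have "((\<lambda>g. g ^ n * s c g / sqrt ((g ^ a * s a g) * (g ^ b * s b g)))
      \<longlongrightarrow> real c / sqrt (real a * real b)) (at_left 1)"
    by (simp add: s_def)
  moreover have "\<forall>\<^sub>F g in at_left 1. g ^ n * s c g / sqrt ((g ^ a * s a g) * (g ^ b * s b g))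
      = (g ^ n - g ^ (a + b)) / sqrt ((g ^ a * (1 - g ^ a)) * (g ^ b * (1 - g ^ b)))"
    using eventually_at_left_real[of 0 1]
  proof (rule eventually_mono)
    fix g :: real assume "g \<in> {0<..<1}"
    then have g: "0 < 1 - g" by simp
    have "g ^ n - g ^ (a + b) = g ^ n * (1 - g ^ c)"
      by (simp add: n power_add algebra_simps)
    then have "g ^ n - g ^ (a + b) = (1 - g) * (g ^ n * s c g)"
      by (simp add: s)
    moreover have "(g ^ a * (1 - g ^ a)) * (g ^ b * (1 - g ^ b))
        = (1 - g)\<^sup>2 * ((g ^ a * s a g) * (g ^ b * s b g))"
      by (simp add: s[of g a] s[of g b] power2_eq_square)
    ultimately show "g ^ n * s c g / sqrt ((g ^ a * s a g) * (g ^ b * s b g))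
      = (g ^ n - g ^ (a + b)) / sqrt ((g ^ a * (1 - g ^ a)) * (g ^ b * (1 - g ^ b)))"
      using g by (simp only: real_sqrt_mult[of "(1 - g)\<^sup>2"] real_sqrt_abs abs_of_pos
          mult_divide_mult_cancel_left[OF less_imp_neq[OF g, symmetric]])
  qed simp
  ultimately show ?thesis by (rule Lim_transform_eventually)
qed

text \<open>The intermediate value theorem between the limits 0 and 1. Continuity of the
  distribution enters the argument here.\<close>

lemma (in real_distribution) cdf_surj:
  assumes cont: "continuous_on UNIV (cdf M)" and y: "0 < y" "y < 1"
  shows "\<exists>t. cdf M t = y"
proof -
  obtain u where u: "cdf M u < y"
    using order_tendstoD(2)[OF cdf_lim_at_bot y(1)] by (metis eventually_at_bot_linorder order_refl)
  obtain v where v: "y < cdf M v"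
    using order_tendstoD(1)[OF cdf_lim_at_top_prob y(2)] by (metis eventually_at_top_linorder order_refl)
  have "u \<le> v" using u v cdf_nondecreasing[of v u] by linarith
  then show ?thesis
    using IVT'[of "cdf M" u y v] u v continuous_on_subset[OF cont] by auto
qed

section \<open>Evaluation of the supremum\<close>

theorem (in iid_reals) max_correlation_minima:
  assumes A: "block A" and B: "block B" and C: "A \<inter> B \<noteq> {}"
    and cont: "continuous_on UNIV (cdf D)"
  shows "max_correlation (U A) (U B) = real (card (A \<inter> B)) / sqrt (real (card A) * real (card B))"
  unfolding max_correlation_def
proof (rule cSup_eq, goal_cases)
  case (1 x)
  then show ?case using correlation_le[OF A B C] by blast
next
  \<comment> \<open>Any upper bound \<open>y\<close> dominates the indicator correlations for every
    tail probability \<open>g\<close> in (0,1), hence also their limit as \<open>g\<close> tends to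
    1 from below.\<close>
  case (2 y)
  obtain i where "i \<in> I" using A by (auto simp: block_def)
  interpret D: real_distribution D by (rule real_distribution_D) fact
  note [measurable] = measurable_U[OF A] measurable_U[OF B]
  have pos: "0 < card A" "0 < card B" using A B by (auto simp: block_def card_gt_0_iff)
  have n: "card A + card B = card (A \<union> B) + card (A \<inter> B)"
    using A B by (intro card_Un_Int) (auto simp: block_def)
  have "(g ^ card (A \<union> B) - g ^ (card A + card B)) /
      sqrt ((g ^ card A * (1 - g ^ card A)) * (g ^ card B * (1 - g ^ card B))) \<le> y"
    if "g \<in> {0<..<1}" for g
  proof -
    from that have g: "0 < g" "g < 1" by auto
    \<comment> \<open>The threshold is chosen to make the tail probability exactly
      \<open>g\<close>.\<close>
    then obtain t where "cdf D t = 1 - g" using D.cdf_surj[OF cont, of "1 - g"] by auto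
    then have t: "1 - cdf D t = g" by simp
    let ?i = "indicator {t<..} :: real \<Rightarrow> real"
    \<comment> \<open>The variance \<open>g ^ k * (1 - g ^ k)\<close>, with
      \<open>k = card S\<close>, is positive because \<open>0 < g < 1\<close> and
      \<open>k > 0\<close>.\<close>
    have fpv: "finite_positive_variance (\<lambda>\<omega>. ?i (U S \<omega>))" if S: "block S" for S
    proof -
      note [measurable] = measurable_U[OF S]
      have "(?i (U S \<omega>))\<^sup>2 = ?i (U S \<omega>)" for \<omega> by (simp add: indicator_def)
      moreover have "0 < card S" using S by (auto simp: block_def card_gt_0_iff)
      ultimately show ?thesis
        using indicator_U(2)[OF S] indicator_correlation(1)[OF S S, of t] g
        by (simp add: finite_positive_variance_def t power_less_one_iff)
    qed
    have "covariance (\<lambda>\<omega>. ?i (U A \<omega>)) (\<lambda>\<omega>. ?i (U B \<omega>)) /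
      sqrt (variance (\<lambda>\<omega>. ?i (U A \<omega>)) * variance (\<lambda>\<omega>. ?i (U B \<omega>))) \<le> y"
      using fpv[OF A] fpv[OF B] by (intro 2) (auto intro!: exI[of _ ?i])
    then show ?thesis
      unfolding indicator_correlation[OF A B] indicator_correlation(1)[OF B A] t .
  qed
  then show ?case
    by (intro tendsto_upperbound[OF indicator_correlation_limit[OF pos n]]
        eventually_mono[OF eventually_at_left_real[of 0 1]]) auto
qed

theorem theorem1p2:
  fixes M :: "'a measure" and X :: "nat \<Rightarrow> 'a \<Rightarrow> real" and D :: "real measure"
    and n m l :: nat
  assumes "prob_space M"
    and "1 \<le> l + 1" and "l + 1 \<le> m" and "m \<le> n"
    and "prob_space.indep_vars M (\<lambda>_. borel) X {1..n}"
    and "\<And>i. i \<in> {1..n} \<Longrightarrow> distr M borel (X i) = D"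
    and "continuous_on UNIV (cdf D)"
  shows "prob_space.max_correlation M
           (\<lambda>\<omega>. MIN i\<in>{1..m}. X i \<omega>) (\<lambda>\<omega>. MIN j\<in>{l + 1..n}. X j \<omega>)
         = (real m - real l) / sqrt (real m * (real n - real l))"
proof -
  interpret iid_reals M X "{1..n}" D
    using assms by (auto simp: iid_reals_def iid_reals_axioms_def)
  have "block {1..m}" "block {l + 1..n}" unfolding block_def using assms by auto
  moreover have C: "{1..m} \<inter> {l + 1..n} = {l + 1..m}" using assms by auto
  moreover have "{l + 1..m} \<noteq> {}" using assms by auto
  ultimately have "max_correlation (U {1..m}) (U {l + 1..n})
      = real (card {l + 1..m}) / sqrt (real (card {1..m}) * real (card {l + 1..n}))"
    using max_correlation_minima[of "{1..m}" "{l + 1..n}"] assms(7) by (simp only: C simp_thms)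
  then show ?thesis
    \<comment> \<open>From \<open>l + 1 \<le> m \<le> n\<close>, the natural-number differences in
      the cardinalities are not truncated and agree with the real ones.\<close>
    using assms(3,4) by (simp add: U_def[abs_def] of_nat_diff)
qed

end
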